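(* Let $G=d_1d_2\ldots d_n$ be a \textsc{flipping coins} position. (1) Suppose $G$ contains at least two $1$s, and let $k<n$ be the two greatest indices whose coins are $1$ (so $d_n=1$ is the last coin). Let $G^{L^*}$ be the Left option obtained by changing $d_k,d_n$ to $0$. Then $G^{L^*}\ge G^L$ for every Left option $G^L$ of $G$. (2) Suppose $G$ contains a $0$, and let $i$ be the greatest index with $d_i=0$. Let $G^{R^*}$ be the Right option obtained by playing the pair $(d_i,d_{i+1})$. Then $G^{R^*}\le G^R$ for every Right option $G^R$ of $G$.
   Context: \textsc{Flipping coins}: a position is a finite string $d_1d_2\ldots d_n$ with each $d_i\in\{0,1\}$ (written left to right). Any $0$s after the last $1$ are deleted, so a position is either empty or ends in $1$. - A Left move chooses indices $i<j$ with $d_i=d_j=1$ and changes both to $0$. - A Right move chooses indices $k<\ell$ with $d_k=0$ and $d_\ell=1$, and changes $d_k$ to $1$ and $d_\ell$ to $0$; this is called playing the pair $(d_k,d_\ell)$. - After any move, trailing $0$s are deleted. The game is played under normal play, and positions are compared as short partizan games. *)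

theory Defs
  imports Main "HOL-Library.FSet"
begin

section \<open>Short partizan games under normal play\<close>

text \<open>Finite sets of options at every level of a well-founded tree: the elements of this type
  are exactly the short games. HOL equality on it is identity of game forms, not equality of
  game values.\<close>

datatype game = Game (left_opts: "game fset") (right_opts: "game fset")

lemma size_left_opts: "x |\<in>| left_opts G \<Longrightarrow> size x < size G"
  and size_right_opts: "x |\<in>| right_opts G \<Longrightarrow> size x < size G"
proof -
  have *: "x |\<in>| A \<Longrightarrow> Suc (size x) \<le> (\<Sum>y\<in>fset A. Suc (size y))" for A :: "game fset"
    by (rule member_le_sum) auto
  show "x |\<in>| left_opts G \<Longrightarrow> size x < size G" "x |\<in>| right_opts G \<Longrightarrow> size x < size G"
    using *[of "left_opts G"] *[of "right_opts G"] by (cases G; simp)+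
qed

text \<open>Normal play: a player who has to move and has no option loses. The predicates say that Left
  has a winning strategy when Left, respectively Right, makes the first move. Since play is finite,
  Right has a winning strategy exactly when Left has none.\<close>

inductive left_wins_first :: "game \<Rightarrow> bool" and left_wins_second :: "game \<Rightarrow> bool" where
  "\<lbrakk>GL |\<in>| left_opts G; left_wins_second GL\<rbrakk> \<Longrightarrow> left_wins_first G"
| "(\<And>GR. GR |\<in>| right_opts G \<Longrightarrow> left_wins_first GR) \<Longrightarrow> left_wins_second G"

function game_sum :: "game \<Rightarrow> game \<Rightarrow> game" where
  "game_sum G H = Game
     ((\<lambda>GL. game_sum GL H) |`| left_opts G |\<union>| (\<lambda>HL. game_sum G HL) |`| left_opts H)
     ((\<lambda>GR. game_sum GR H) |`| right_opts G |\<union>| (\<lambda>HR. game_sum G HR) |`| right_opts H)"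
  by pat_completeness auto
termination
  by (relation "measure (\<lambda>(G, H). size G + size H)")
    (auto dest: size_left_opts size_right_opts)

declare game_sum.simps [simp del]

text \<open>\<open>G \<le> H\<close> means that for every short game \<open>X\<close> the outcome of \<open>H + X\<close> is at least as good for
  Left as that of \<open>G + X\<close>, with outcome classes ordered by L > P > R, L > N > R, and
  P and N
  incomparable. Antisymmetry only holds up to equality of values, so this is a preorder.\<close>

instantiation game :: "{plus, preorder}"
begin

definition plus_game :: "game \<Rightarrow> game \<Rightarrow> game" where
  "G + H = game_sum G H"

definition less_eq_game :: "game \<Rightarrow> game \<Rightarrow> bool" where
  "G \<le> H \<longleftrightarrow> (\<forall>X.
     (left_wins_first (G + X) \<longrightarrow> left_wins_first (H + X)) \<and>
     (left_wins_second (G + X) \<longrightarrow> left_wins_second (H + X)))"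

definition less_game :: "game \<Rightarrow> game \<Rightarrow> bool" where
  "G < H \<longleftrightarrow> G \<le> H \<and> \<not> H \<le> (G :: game)"

instance
  by standard (auto simp: less_eq_game_def less_game_def)

end


section \<open>Flipping coins\<close>

text \<open>A string is a list of coins, \<open>True\<close> for 1 and \<open>False\<close> for 0. Indices start at 0, so the
  coin \<open>d\<^sub>i\<close> of \<open>d\<^sub>1\<dots>d\<^sub>n\<close> is \<open>ds ! (i - 1)\<close>.\<close>

definition is_position :: "bool list \<Rightarrow> bool" where
  "is_position ds \<longleftrightarrow> ds = [] \<or> last ds"

definition trim :: "bool list \<Rightarrow> bool list" where
  "trim ds = rev (dropWhile Not (rev ds))"

definition ones :: "bool list \<Rightarrow> nat set" where
  "ones ds = {i. i < length ds \<and> ds ! i}"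

definition zeros :: "bool list \<Rightarrow> nat set" where
  "zeros ds = {i. i < length ds \<and> \<not> ds ! i}"

definition left_move :: "bool list \<Rightarrow> nat \<Rightarrow> nat \<Rightarrow> bool list" where
  "left_move ds i j = trim (ds[i := False, j := False])"

definition right_move :: "bool list \<Rightarrow> nat \<Rightarrow> nat \<Rightarrow> bool list" where
  "right_move ds k l = trim (ds[k := True, l := False])"

definition left_positions :: "bool list \<Rightarrow> bool list set" where
  "left_positions ds = {left_move ds i j | i j. i < j \<and> i \<in> ones ds \<and> j \<in> ones ds}"

definition right_positions :: "bool list \<Rightarrow> bool list set" where
  "right_positions ds = {right_move ds k l | k l. k < l \<and> k \<in> zeros ds \<and> l \<in> ones ds}"

lemma finite_ones [simp]: "finite (ones ds)"
  and finite_zeros [simp]: "finite (zeros ds)"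
  by (simp_all add: ones_def zeros_def)

lemma finite_left_positions [simp]: "finite (left_positions ds)"
proof -
  have "left_positions ds \<subseteq> (\<lambda>(i, j). left_move ds i j) ` (ones ds \<times> ones ds)"
    by (auto simp: left_positions_def)
  then show ?thesis
    by (rule finite_subset) simp
qed

lemma finite_right_positions [simp]: "finite (right_positions ds)"
proof -
  have "right_positions ds \<subseteq> (\<lambda>(k, l). right_move ds k l) ` (zeros ds \<times> ones ds)"
    by (auto simp: right_positions_def)
  then show ?thesis
    by (rule finite_subset) simp
qed

lemma is_position_trim [simp]: "is_position (trim ds)"
  by (induction ds rule: rev_induct) (auto simp: trim_def is_position_def)

lemma ones_trim [simp]: "ones (trim ds) = ones ds"
proof (induction ds rule: rev_induct)
  case (snoc d ds)
  have "ones (ds @ [False]) = ones ds"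
    unfolding ones_def by (rule Collect_cong) (auto simp: nth_append less_Suc_eq)
  then show ?case
    using snoc.IH by (cases d) (simp_all add: trim_def)
qed (simp add: trim_def)

text \<open>Either move lowers the sum of the 1-based indices of the 1s, so play terminates.\<close>

lemma sum_ones_left_positions:
  assumes "es \<in> left_positions ds"
  shows "sum Suc (ones es) < sum Suc (ones ds)"
proof -
  from assms obtain i j where "es = left_move ds i j" "i < j" "i \<in> ones ds" "j \<in> ones ds"
    by (auto simp: left_positions_def)
  then have "ones es = ones ds - {i, j}"
    by (auto simp: left_move_def) (auto simp: ones_def nth_list_update split: if_splits)
  with \<open>i \<in> ones ds\<close> show ?thesis
    by (intro sum_strict_mono2[where b = i]) auto
qed

lemma sum_ones_right_positions:
  assumes "es \<in> right_positions ds"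
  shows "sum Suc (ones es) < sum Suc (ones ds)"
proof -
  from assms obtain k l where kl: "es = right_move ds k l" "k < l" "k \<in> zeros ds" "l \<in> ones ds"
    by (auto simp: right_positions_def)
  have es: "ones es = insert k (ones ds - {l})"
    using kl by (auto simp: right_move_def)
      (auto simp: ones_def zeros_def nth_list_update split: if_splits)
  have "sum Suc (ones es) = Suc k + sum Suc (ones ds - {l})"
    using kl unfolding es by (subst sum.insert) (auto simp: zeros_def ones_def)
  also have "\<dots> < Suc l + sum Suc (ones ds - {l})"
    using kl by simp
  also have "\<dots> = sum Suc (ones ds)"
    using kl sum.remove[of "ones ds" l Suc] by simp
  finally show ?thesis .
qed

function game_of :: "bool list \<Rightarrow> game" where
  "game_of ds = Game
     (Abs_fset (game_of ` left_positions ds))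
     (Abs_fset (game_of ` right_positions ds))"
  by pat_completeness auto
termination
  by (relation "measure (\<lambda>ds. sum Suc (ones ds))")
    (auto dest: sum_ones_left_positions sum_ones_right_positions)

declare game_of.simps [simp del]

text \<open>\<open>Abs_fset\<close> is only meaningful on finite sets; all of the option sets here are finite.\<close>

lemma fset_left_opts_game_of: "fset (left_opts (game_of ds)) = game_of ` left_positions ds"
  and fset_right_opts_game_of: "fset (right_opts (game_of ds)) = game_of ` right_positions ds"
  by (subst game_of.simps, simp add: Abs_fset_inverse)+

end

theory Submission
  imports Defs
begin

text \<open>Only the set of indices of the 1s matters. Call one set below another of the same size if
  it is so elementwise after sorting. If \<open>S\<close> is below \<open>T\<close>, then \<open>S\<close> is at least as good for Left:
  a Right move in \<open>S\<close> leads to a set strictly below \<open>T\<close>, and some Right move in \<open>T\<close> stays above that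
  set, while a removal of two 1s from \<open>T\<close> is answered by the removal of the two last 1s of \<open>S\<close>. This
  gives (1), and it gives (2) for the Right moves \<open>(k, l)\<close> with \<open>k \<le> i < l\<close>. For \<open>k < l < i\<close> the two
  options \<open>A\<close> (after \<open>(k, l)\<close>) and \<open>B\<close> (after \<open>(i, i + 1)\<close>) are incomparable elementwise, and one
  inducts. By the induction hypothesis the best Right move in \<open>A\<close> is \<open>(i, i + 1)\<close>, which is matched
  by \<open>(k, l)\<close> in \<open>B\<close>. The best Left move in \<open>B\<close> is matched by the removal of the last two 1s of
  \<open>A\<close>: this is the induction hypothesis for the position without these two 1s if at least three 1s
  follow \<open>i\<close>, and the elementwise comparison otherwise.\<close>

section \<open>Comparing games by matching options\<close>

lemma left_wins_first_iff: "left_wins_first G \<longleftrightarrow> (\<exists>L. L |\<in>| left_opts G \<and> left_wins_second L)"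
  by (subst left_wins_first.simps) auto

lemma left_wins_second_iff: "left_wins_second G \<longleftrightarrow> (\<forall>R. R |\<in>| right_opts G \<longrightarrow> left_wins_first R)"
  by (subst left_wins_second.simps) auto

lemma left_opts_plus:
  "L |\<in>| left_opts (G + X) \<longleftrightarrow>
     (\<exists>GL. GL |\<in>| left_opts G \<and> L = GL + X) \<or> (\<exists>XL. XL |\<in>| left_opts X \<and> L = G + XL)"
  unfolding plus_game_def by (subst game_sum.simps) auto

lemma right_opts_plus:
  "R |\<in>| right_opts (G + X) \<longleftrightarrow>
     (\<exists>GR. GR |\<in>| right_opts G \<and> R = GR + X) \<or> (\<exists>XR. XR |\<in>| right_opts X \<and> R = G + XR)"
  unfolding plus_game_def by (subst game_sum.simps) auto

text \<open>Induction on the size of \<open>X\<close>: a move inside \<open>X\<close> is copied and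
  the induction hypothesis applies; a move in \<open>G\<close> or \<open>H\<close> is replaced by
  its matching option, whose inequality already covers every \<open>X\<close>. Matching options is
  sufficient for \<open>G \<le> H\<close>, not equivalent to it.\<close>

lemma game_leI:
  fixes G H :: game
  assumes right: "\<And>HR. HR |\<in>| right_opts H \<Longrightarrow> \<exists>GR. GR |\<in>| right_opts G \<and> GR \<le> HR"
    and left: "\<And>GL. GL |\<in>| left_opts G \<Longrightarrow> \<exists>HL. HL |\<in>| left_opts H \<and> GL \<le> HL"
  shows "G \<le> H"
proof -
  have "(left_wins_first (G + X) \<longrightarrow> left_wins_first (H + X)) \<and>
        (left_wins_second (G + X) \<longrightarrow> left_wins_second (H + X))" for X
  proof (induction X rule: measure_induct_rule[of size])
    case (less X)
    have "left_wins_first (H + X)" if "left_wins_first (G + X)"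
    proof -
      from that obtain L where L: "L |\<in>| left_opts (G + X)" "left_wins_second L"
        by (auto simp: left_wins_first_iff)
      from L(1) consider GL where "GL |\<in>| left_opts G" "L = GL + X"
        | XL where "XL |\<in>| left_opts X" "L = G + XL"
        by (auto simp: left_opts_plus)
      then show ?thesis
      proof cases
        case 1
        then obtain HL where "HL |\<in>| left_opts H" "GL \<le> HL"
          using left by blast
        then have "HL + X |\<in>| left_opts (H + X)" "left_wins_second (HL + X)"
          using 1 L(2) by (auto simp: left_opts_plus less_eq_game_def)
        then show ?thesis
          by (rule left_wins_first_left_wins_second.intros)
      next
        case 2
        then have "H + XL |\<in>| left_opts (H + X)" "left_wins_second (H + XL)"
          using L(2) less.IH[OF size_left_opts[OF 2(1)]] by (auto simp: left_opts_plus)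
        then show ?thesis
          by (rule left_wins_first_left_wins_second.intros)
      qed
    qed
    moreover have "left_wins_second (H + X)" if second: "left_wins_second (G + X)"
      unfolding left_wins_second_iff[of "H + X"]
    proof (intro allI impI)
      fix R
      assume "R |\<in>| right_opts (H + X)"
      then consider HR where "HR |\<in>| right_opts H" "R = HR + X"
        | XR where "XR |\<in>| right_opts X" "R = H + XR"
        by (auto simp: right_opts_plus)
      then show "left_wins_first R"
      proof cases
        case 1
        then obtain GR where "GR |\<in>| right_opts G" "GR \<le> HR"
          using right by blast
        then have "left_wins_first (GR + X)"
          using second by (auto simp: left_wins_second_iff right_opts_plus)
        with 1 \<open>GR \<le> HR\<close> show ?thesis
          by (simp add: less_eq_game_def)
      next
        case 2
        then have "left_wins_first (G + XR)"
          using second by (auto simp: left_wins_second_iff right_opts_plus)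
        with 2 less.IH[OF size_right_opts[OF 2(1)]] show ?thesis
          by simp
      qed
    qed
    ultimately show ?case by blast
  qed
  then show ?thesis by (simp add: less_eq_game_def)
qed

lemma game_of_leI:
  assumes "\<And>R. R \<in> right_positions es \<Longrightarrow> \<exists>R'\<in>right_positions ds. game_of R' \<le> game_of R"
    and "\<And>L. L \<in> left_positions ds \<Longrightarrow> \<exists>L'\<in>left_positions es. game_of L \<le> game_of L'"
  shows "game_of ds \<le> game_of es"
  using assms by (intro game_leI) (auto simp: fset_left_opts_game_of fset_right_opts_game_of)


section \<open>Moves as operations on the set of 1s\<close>

text \<open>An index below that of a 1 lies inside the string. Hence Right moves can be described
  through \<open>ones\<close> alone, without reference to the length.\<close>

lemma mem_zeros_if_less_ones: "k < l \<Longrightarrow> k \<notin> ones ds \<Longrightarrow> l \<in> ones ds \<Longrightarrow> k \<in> zeros ds"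
  by (auto simp: ones_def zeros_def)

lemma zeros_not_ones: "k \<in> zeros ds \<Longrightarrow> k \<notin> ones ds"
  by (auto simp: ones_def zeros_def)

lemma ones_update_False: "ones (ds[i := False]) = ones ds - {i}"
  by (cases "i < length ds") (auto simp: ones_def nth_list_update split: if_splits)

lemma ones_left_move: "ones (left_move ds i j) = ones ds - {i, j}"
  by (auto simp: left_move_def ones_update_False)

lemma ones_right_move:
  "k < l \<Longrightarrow> l \<in> ones ds \<Longrightarrow> ones (right_move ds k l) = insert k (ones ds - {l})"
  by (auto simp: right_move_def) (auto simp: ones_def nth_list_update split: if_splits)

lemma left_move_in_left_positions:
  "i < j \<Longrightarrow> i \<in> ones ds \<Longrightarrow> j \<in> ones ds \<Longrightarrow> left_move ds i j \<in> left_positions ds"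
  by (auto simp: left_positions_def)

lemma right_move_in_right_positions:
  "k < l \<Longrightarrow> k \<notin> ones ds \<Longrightarrow> l \<in> ones ds \<Longrightarrow> right_move ds k l \<in> right_positions ds"
  unfolding right_positions_def using mem_zeros_if_less_ones by blast

lemma right_positionsE:
  assumes "R \<in> right_positions ds"
  obtains k l where "R = right_move ds k l" "k < l" "k \<notin> ones ds" "l \<in> ones ds"
  using assms zeros_not_ones by (auto simp: right_positions_def)


section \<open>The elementwise order\<close>

text \<open>Tail counts replace sorting: for finite sets of equal size, every tail of
  \<open>S\<close> is at most as large as that of \<open>T\<close> iff the j-th greatest element of
  \<open>S\<close> is at most that of \<open>T\<close> for every j.\<close>

definition count_from :: "nat set \<Rightarrow> nat \<Rightarrow> nat" where
  "count_from S m = card (S \<inter> {m..})"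

lemma count_from_antimono: "finite S \<Longrightarrow> m \<le> m' \<Longrightarrow> count_from S m' \<le> count_from S m"
  unfolding count_from_def by (intro card_mono) auto

lemma count_from_eq_Suc:
  assumes "finite S"
  shows "count_from S m = count_from S (Suc m) + of_bool (m \<in> S)"
proof (cases "m \<in> S")
  case True
  then have "S \<inter> {m..} = insert m (S \<inter> {Suc m..})"
    by (auto simp: not_less_eq_eq)
  with assms True show ?thesis by (simp add: count_from_def)
next
  case False
  then have "S \<inter> {m..} = S \<inter> {Suc m..}"
    by (auto simp: Suc_le_eq order_le_less)
  with False show ?thesis by (simp add: count_from_def)
qed

lemma count_from_remove:
  assumes "finite S" "l \<in> S"
  shows "count_from (S - {l}) m = count_from S m - of_bool (m \<le> l)"
proof -
  have "(S - {l}) \<inter> {m..} = S \<inter> {m..} - {l}" by auto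
  with assms show ?thesis by (simp add: count_from_def card_Diff_singleton_if)
qed

lemma count_from_insert:
  assumes "finite S" "k \<notin> S"
  shows "count_from (insert k S) m = count_from S m + of_bool (m \<le> k)"
  using assms by (auto simp: count_from_def Int_insert_left)

lemma count_from_pos: "finite S \<Longrightarrow> l \<in> S \<Longrightarrow> m \<le> l \<Longrightarrow> 0 < count_from S m"
  by (auto simp: count_from_def card_gt_0_iff)

lemma count_from_shift:
  assumes "finite S" "k < l" "k \<notin> S" "l \<in> S"
  shows "count_from (insert k (S - {l})) m = count_from S m - of_bool (k < m \<and> m \<le> l)"
  \<comment> \<open>For \<open>m \<le> l\<close> the element \<open>l\<close> is itself counted, so
    the subtraction of 1 is not truncated.\<close>
  using assms count_from_pos[OF assms(1,4), of m]
  by (auto simp: count_from_insert count_from_remove)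

lemma count_from_remove2:
  assumes "finite S" "i < j" "i \<in> S" "j \<in> S"
  shows "count_from (S - {i, j}) m = count_from S m - of_bool (m \<le> i) - of_bool (m \<le> j)"
proof -
  have "S - {i, j} = S - {i} - {j}"
    by (rule Diff_insert2)
  also have "count_from \<dots> m = count_from (S - {i}) m - of_bool (m \<le> j)"
    using assms by (intro count_from_remove) auto
  also have "count_from (S - {i}) m = count_from S m - of_bool (m \<le> i)"
    using assms by (intro count_from_remove)
  finally show ?thesis .
qed

section \<open>The two greatest elements of a set\<close>

definition top_two :: "nat set \<Rightarrow> nat \<Rightarrow> nat \<Rightarrow> bool" where
  "top_two S p q \<longleftrightarrow> p < q \<and> p \<in> S \<and> q \<in> S \<and> (\<forall>x\<in>S. x \<noteq> q \<longrightarrow> x \<le> p)"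

lemma top_two_Max:
  assumes "finite S" "2 \<le> card S"
  shows "top_two S (Max (S - {Max S})) (Max S)"
proof -
  have ne: "S \<noteq> {}" using assms by auto
  have ne': "S - {Max S} \<noteq> {}"
  proof
    assume "S - {Max S} = {}"
    then have "S \<subseteq> {Max S}" by auto
    then have "card S \<le> 1" using card_mono[of "{Max S}" S] by simp
    with assms show False by simp
  qed
  have "Max (S - {Max S}) \<in> S - {Max S}"
    using assms ne' by (intro Max_in) auto
  moreover from this have "Max (S - {Max S}) \<le> Max S"
    using assms by (intro Max_ge) auto
  moreover have "x \<le> Max (S - {Max S})" if "x \<in> S" "x \<noteq> Max S" for x
    using assms that by (intro Max_ge) auto
  ultimately show ?thesis
    using assms ne by (auto simp: top_two_def order_le_less)
qed

text \<open>Truncated subtraction is intended: beyond \<open>p\<close> at most \<open>q\<close> is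
  counted, and the tail becomes empty.\<close>

lemma count_from_remove_top_two:
  assumes "finite S" "top_two S p q"
  shows "count_from (S - {p, q}) m = count_from S m - 2"
proof (cases "m \<le> p")
  case True
  with assms show ?thesis by (simp add: count_from_remove2 top_two_def)
next
  case False
  with assms have sub: "S \<inter> {m..} \<subseteq> {q}" by (fastforce simp: top_two_def)
  then have "(S - {p, q}) \<inter> {m..} = {}" by auto
  moreover have "count_from S m \<le> 1"
    using card_mono[OF _ sub] by (simp add: count_from_def)
  ultimately show ?thesis by (simp add: count_from_def)
qed

section \<open>Elementwise comparison of sets of equal size\<close>

definition below :: "nat set \<Rightarrow> nat set \<Rightarrow> bool" where
  "below S T \<longleftrightarrow> count_from S 0 = count_from T 0 \<and> (\<forall>m. count_from S m \<le> count_from T m)"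

lemma below_shift:
  assumes "finite S" "k < l" "k \<notin> S" "l \<in> S"
  shows "below (insert k (S - {l})) S"
  using assms by (auto simp: below_def count_from_shift)

lemma below_trans: "below S T \<Longrightarrow> below T U \<Longrightarrow> below S U"
  by (auto simp: below_def intro: order_trans)

text \<open>Removing the two greatest elements takes 2 from every tail, as far as it has them; any
  other pair takes at most 2.\<close>

lemma below_remove_top_two:
  assumes "finite S" "finite T" "below S T" "top_two S p q" "i < j" "i \<in> T" "j \<in> T"
  shows "below (S - {p, q}) (T - {i, j})"
proof -
  have "count_from (T - {i, j}) 0 = count_from T 0 - 2"
  using assms by (simp add: count_from_remove2)
  moreover have "count_from (S - {p, q}) m \<le> count_from (T - {i, j}) m" for m
  proof -
    have "count_from S m - 2 \<le> count_from T m - 2"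
      using assms(3) by (simp add: below_def diff_le_mono)
    also have "\<dots> \<le> count_from (T - {i, j}) m"
      using assms by (auto simp: count_from_remove2)
    finally show ?thesis
      using assms by (simp add: count_from_remove_top_two)
  qed
  ultimately show ?thesis
    using assms by (auto simp: below_def count_from_remove_top_two)
qed

text \<open>This supplies Right's move in \<open>T\<close> that stays above \<open>S\<close>. Take
  the least threshold \<open>m\<close> at which the tails differ, move the first element
  \<open>l \<ge> m\<close> of \<open>T\<close> down to \<open>k = m - 1\<close>, and check that only
  thresholds with strict inequality lose 1.\<close>

lemma below_strict_shift:
  assumes fin: "finite S" "finite T" and below: "below S T"
    and strict: "count_from S m0 < count_from T m0"
  obtains k l where "k < l" "k \<notin> T" "l \<in> T" "below S (insert k (T - {l}))"
proof -
  define m where "m = (LEAST m. count_from S m < count_from T m)"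
  have m: "count_from S m < count_from T m"
    unfolding m_def using strict by (rule LeastI)
  have least: "count_from S m' = count_from T m'" if "m' < m" for m'
    using not_less_Least[of m' "\<lambda>m. count_from S m < count_from T m"] that below
    by (simp add: m_def below_def le_antisym not_less)
  \<comment> \<open>The sets have equal size, so the tails agree at 0 and \<open>m\<close> has a
    predecessor.\<close>
  have "m \<noteq> 0" using m below by (metis below_def less_irrefl)
  then obtain k where k: "m = Suc k" by (cases m) auto
  \<comment> \<open>Were \<open>k\<close> in \<open>T\<close>, the tail of \<open>T\<close> at
    \<open>k\<close> would exceed its tail at \<open>m\<close> by 1, while that of \<open>S\<close>
    grows by at most 1; the tails could not agree at \<open>k\<close>.\<close>
  have "k \<notin> T"
    using count_from_eq_Suc[OF fin(1), of k] count_from_eq_Suc[OF fin(2), of k] least[of k] m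
    by (cases "k \<in> S") (auto simp: k)
  have "T \<inter> {m..} \<noteq> {}"
    using m by (auto simp: count_from_def)
  define l where "l = Min (T \<inter> {m..})"
  have l: "l \<in> T" "m \<le> l"
    using Min_in[of "T \<inter> {m..}"] fin \<open>T \<inter> {m..} \<noteq> {}\<close> by (auto simp: l_def)
  \<comment> \<open>From \<open>m\<close> to \<open>l\<close> the tail of \<open>T\<close> is
    constant and that of \<open>S\<close> can only shrink, so strictness persists.\<close>
  have Tl: "count_from S x < count_from T x" if "m \<le> x" "x \<le> l" for x
  proof -
    have "T \<inter> {x..} = T \<inter> {m..}"
      using that fin Min_le[of "T \<inter> {m..}"] by (force simp: l_def[symmetric])
    then have "count_from T x = count_from T m" by (simp add: count_from_def)
    with m count_from_antimono[OF fin(1) that(1)] show ?thesis by simp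
  qed
  show ?thesis
  proof (rule that)
    show "k < l" "k \<notin> T" "l \<in> T" using k l \<open>k \<notin> T\<close> by auto
    then have shift: "count_from (insert k (T - {l})) x = count_from T x - of_bool (k < x \<and> x \<le> l)" for x
      using fin by (intro count_from_shift)
    have "count_from S x \<le> count_from (insert k (T - {l})) x" for x
      using below Tl[of x] by (cases "k < x \<and> x \<le> l") (auto simp: shift below_def k)
    then show "below S (insert k (T - {l}))"
      using below by (simp add: below_def shift)
  qed
qed

lemma top_two_exists:
  assumes "finite S" "2 \<le> count_from S 0"
  shows "\<exists>p q. top_two S p q"
  using assms top_two_Max[of S] by (auto simp: count_from_def)

lemma count_from_two:
  assumes "finite T" "i < j" "i \<in> T" "j \<in> T"
  shows "2 \<le> count_from T 0"
  using card_mono[of T "{i, j}"] assms by (auto simp: count_from_def)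


section \<open>Lowering 1s favours Left\<close>

lemma game_of_le_if_below:
  "below (ones es) (ones ds) \<Longrightarrow> game_of ds \<le> game_of es"
\<comment> \<open>In every matched pair both positions have moved, so both summands drop.\<close>
proof (induction "sum Suc (ones ds) + sum Suc (ones es)" arbitrary: ds es rule: less_induct)
  case less
  note below = \<open>below (ones es) (ones ds)\<close>
  show ?case
  proof (rule game_of_leI)
    fix R
    assume R: "R \<in> right_positions es"
    then obtain k l where kl: "R = right_move es k l" "k < l" "k \<notin> ones es" "l \<in> ones es"
      by (rule right_positionsE)
    then have "below (ones R) (ones es)"
      by (simp add: ones_right_move below_shift)
    then have R_below: "below (ones R) (ones ds)"
      using below by (rule below_trans)
    \<comment> \<open>Threshold \<open>l\<close> witnesses strictness: Right's move in
      \<open>es\<close> has taken the coin at \<open>l\<close> out of this tail.\<close>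
    have "count_from (ones R) l < count_from (ones es) l"
      using kl count_from_pos[of "ones es" l l] by (simp add: ones_right_move count_from_shift)
    then have "count_from (ones R) l < count_from (ones ds) l"
      using below by (auto simp: below_def intro: less_le_trans)
    from below_strict_shift[OF finite_ones finite_ones R_below this]
    obtain k' l' where k'l': "k' < l'" "k' \<notin> ones ds" "l' \<in> ones ds"
      "below (ones R) (insert k' (ones ds - {l'}))" .
    define R' where "R' = right_move ds k' l'"
    have R': "R' \<in> right_positions ds" "below (ones R) (ones R')"
      using k'l' by (simp_all add: R'_def right_move_in_right_positions ones_right_move)
    have "game_of R' \<le> game_of R"
      using sum_ones_right_positions[OF R] sum_ones_right_positions[OF R'(1)] R'(2)
      by (intro less.hyps) auto
    with R' show "\<exists>R'\<in>right_positions ds. game_of R' \<le> game_of R" by blast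
  next
    fix L
    assume L: "L \<in> left_positions ds"
    then obtain i j where ij: "L = left_move ds i j" "i < j" "i \<in> ones ds" "j \<in> ones ds"
      by (auto simp: left_positions_def)
    then have "2 \<le> count_from (ones es) 0"
      using below count_from_two[of "ones ds" i j] by (simp add: below_def)
    then obtain p q where pq: "top_two (ones es) p q"
      using top_two_exists[OF finite_ones] by blast
    define L' where "L' = left_move es p q"
    have L': "L' \<in> left_positions es"
      using pq by (auto simp: L'_def top_two_def intro: left_move_in_left_positions)
    have "below (ones L') (ones L)"
      using below_remove_top_two[OF _ _ below pq] ij by (simp add: L'_def ones_left_move)
    then have "game_of L \<le> game_of L'"
      using sum_ones_left_positions[OF L] sum_ones_left_positions[OF L']
      by (intro less.hyps) auto
    with L' show "\<exists>L'\<in>left_positions es. game_of L \<le> game_of L'" by blast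
  qed
qed

text \<open>This identifies the results of commuting moves up to value, without showing that the
  strings coincide.\<close>

lemma game_of_le_if_ones_eq: "ones ds = ones es \<Longrightarrow> game_of ds \<le> game_of es"
  by (rule game_of_le_if_below) (simp add: below_def)

text \<open>\<open>below\<close> is reflexive, so \<open>below_remove_top_two\<close> applies to the
  set of 1s and itself.\<close>

lemma left_positions_le_top_two:
  assumes "top_two (ones ds) p q" "L \<in> left_positions ds"
  shows "game_of L \<le> game_of (left_move ds p q)"
proof -
  from assms(2) obtain i j where ij: "L = left_move ds i j" "i < j" "i \<in> ones ds" "j \<in> ones ds"
    by (auto simp: left_positions_def)
  have "below (ones ds) (ones ds)" by (simp add: below_def)
  from below_remove_top_two[OF finite_ones finite_ones this assms(1) ij(2-4)] show ?thesis
    by (intro game_of_le_if_below) (simp add: ij(1) ones_left_move)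
qed


section \<open>The best Right move\<close>

text \<open>The greatest 0, expressed by the 1s only: from \<open>Suc i\<close> to the greatest
  element there is no hole.\<close>

definition last_gap :: "nat set \<Rightarrow> nat \<Rightarrow> bool" where
  "last_gap S i \<longleftrightarrow> i \<notin> S \<and> Suc i \<in> S \<and> (\<forall>x\<in>S. \<forall>y. i < y \<and> y < x \<longrightarrow> y \<in> S)"

lemma right_move_last_gap_le:
  assumes "last_gap (ones ds) i" "k < l" "k \<notin> ones ds" "l \<in> ones ds"
  shows "game_of (right_move ds i (Suc i)) \<le> game_of (right_move ds k l)"
  using assms
\<comment> \<open>The index \<open>i\<close> stays fixed: the induction hypothesis is used only for
  positions with the same last gap.\<close>
proof (induction "sum Suc (ones ds)" arbitrary: ds k l rule: less_induct)
  case less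
  note gap = \<open>last_gap (ones ds) i\<close> and kl = \<open>k < l\<close> \<open>k \<notin> ones ds\<close> \<open>l \<in> ones ds\<close>
  have i: "i \<notin> ones ds" "Suc i \<in> ones ds"
    using gap by (auto simp: last_gap_def)
  define A B where "A = right_move ds k l" and "B = right_move ds i (Suc i)"
  have A: "A \<in> right_positions ds" "ones A = insert k (ones ds - {l})"
    using kl by (simp_all add: A_def right_move_in_right_positions ones_right_move)
  have B: "ones B = insert i (ones ds - {Suc i})"
    using i by (simp add: B_def ones_right_move)
  have count_A: "count_from (ones A) m = count_from (ones ds) m - of_bool (k < m \<and> m \<le> l)" for m
    unfolding A using kl by (simp add: count_from_shift)
  have count_B: "count_from (ones B) m = count_from (ones ds) m - of_bool (i < m \<and> m \<le> Suc i)" for m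
    unfolding B using i by (intro count_from_shift) auto
  have "k \<le> i"
  proof (rule ccontr)
    assume "\<not> k \<le> i"
    with gap kl show False by (auto simp: last_gap_def)
  qed
  have "game_of B \<le> game_of A"
  proof (cases "i < l")
    case True
    \<comment> \<open>\<open>B\<close> loses 1 only at threshold \<open>Suc i\<close>, which lies in
      the range from \<open>Suc k\<close> to \<open>l\<close> where \<open>A\<close> loses
      1.\<close>
    with \<open>k \<le> i\<close> have "below (ones A) (ones B)"
      by (auto simp: below_def count_A count_B)
    then show ?thesis by (rule game_of_le_if_below)
  next
    case False
    with kl i have "l < i" by (metis linorder_neqE_nat)
    show ?thesis
    proof (rule game_of_leI)
      fix R
      assume "R \<in> right_positions A"
      then obtain a b where ab: "R = right_move A a b" "a < b" "a \<notin> ones A" "b \<in> ones A"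
        by (rule right_positionsE)
      have gap_A: "last_gap (ones A) i"
        using gap kl \<open>l < i\<close> by (auto simp: last_gap_def A(2))
      \<comment> \<open>The move from \<open>l\<close> to \<open>k\<close> happens below
        \<open>i\<close>, so \<open>A\<close> keeps the gap and its best Right move is known by
        induction.\<close>
      have *: "game_of (right_move A i (Suc i)) \<le> game_of R"
        unfolding ab(1) using sum_ones_right_positions[OF A(1)] gap_A ab(2-4) by (rule less.hyps)
      have "k \<notin> ones B" "l \<in> ones B"
        using kl \<open>l < i\<close> by (auto simp: B)
      then have R': "right_move B k l \<in> right_positions B"
        and ones_R': "ones (right_move B k l) = insert k (ones B - {l})"
        using kl by (simp_all add: ones_right_move right_move_in_right_positions)
      \<comment> \<open>The two Right moves use disjoint pairs of coins and commute.\<close>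
      have "ones (right_move A i (Suc i)) = insert i (ones A - {Suc i})"
        using gap_A by (simp add: ones_right_move last_gap_def)
      also have "\<dots> = ones (right_move B k l)"
        using kl(1) \<open>l < i\<close> by (simp add: ones_R' A(2) B insert_Diff_if insert_commute
            Diff_insert2[symmetric])
      finally have "game_of (right_move B k l) \<le> game_of (right_move A i (Suc i))"
        by (intro game_of_le_if_ones_eq) (rule sym)
      from order_trans[OF this *] R' show "\<exists>R'\<in>right_positions B. game_of R' \<le> game_of R"
        by blast
    next
      fix L
      assume L: "L \<in> left_positions B"
      \<comment> \<open>The 1s at \<open>l\<close> and \<open>Suc i\<close> are distinct, and Right
        moves preserve the number of 1s.\<close>
      have "2 \<le> count_from (ones ds) 0"
        using count_from_two[of "ones ds" l "Suc i"] kl i \<open>l < i\<close> by simp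
      then have two: "2 \<le> count_from (ones A) 0" "2 \<le> count_from (ones B) 0"
        by (simp_all add: count_A count_B)
      show "\<exists>L'\<in>left_positions A. game_of L \<le> game_of L'"
      proof (cases "count_from (ones ds) (Suc i) \<le> 2")
        case True
        obtain p q where pq: "top_two (ones A) p q"
          using two(1) top_two_exists[OF finite_ones] by blast
        obtain p' q' where pq': "top_two (ones B) p' q'"
          using two(2) top_two_exists[OF finite_ones] by blast
        have "below (ones (left_move A p q)) (ones (left_move B p' q'))"
          unfolding below_def ones_left_move count_from_remove_top_two[OF finite_ones pq]
            count_from_remove_top_two[OF finite_ones pq']
        proof (intro conjI allI)
          show "count_from (ones A) 0 - 2 = count_from (ones B) 0 - 2"
            by (simp add: count_A count_B)
          \<comment> \<open>Only at \<open>Suc i\<close> is the tail of \<open>B\<close> smaller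
            than that of \<open>ds\<close>; there at most two 1s remain, so the left side is
            0.\<close>
          show "count_from (ones A) m - 2 \<le> count_from (ones B) m - 2" for m
            using True by (cases "m = Suc i") (auto simp: count_A count_B)
        qed
        then have "game_of (left_move B p' q') \<le> game_of (left_move A p q)"
          by (rule game_of_le_if_below)
        from order_trans[OF left_positions_le_top_two[OF pq' L] this] pq show ?thesis
          by (auto simp: top_two_def intro: left_move_in_left_positions)
      next
        case False
        obtain p q where pq: "top_two (ones ds) p q"
          using \<open>2 \<le> count_from (ones ds) 0\<close> top_two_exists[OF finite_ones] by blast
        define T where "T = left_move ds p q"
        have T: "T \<in> left_positions ds" "ones T = ones ds - {p, q}"
          using pq by (auto simp: T_def top_two_def ones_left_move intro: left_move_in_left_positions)
        \<comment> \<open>At least three 1s follow \<open>i\<close>, so some \<open>x\<close> among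
          them survives in \<open>T\<close>. Then \<open>Suc i \<le> x < p\<close>, so the coin at
          \<open>Suc i\<close> survives too, and \<open>T\<close> has the same last gap.\<close>
        have "0 < count_from (ones T) (Suc i)"
          unfolding T count_from_remove_top_two[OF finite_ones pq] using False by simp
        then obtain x where x: "x \<in> ones T" "Suc i \<le> x"
          by (auto simp: count_from_def card_gt_0_iff)
        with pq have "x < p" by (auto simp: T(2) top_two_def order_le_less)
        with x have p: "Suc i < p" and q: "Suc i < q"
          using pq by (auto simp: top_two_def)
        have gap_T: "last_gap (ones T) i"
          using gap pq p q by (fastforce simp: last_gap_def T(2) top_two_def)
        have l: "k \<notin> ones T" "l \<in> ones T"
          using kl \<open>l < i\<close> p q by (auto simp: T(2))
        have le: "game_of (right_move T i (Suc i)) \<le> game_of (right_move T k l)"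
          using sum_ones_left_positions[OF T(1)] gap_T kl(1) l by (rule less.hyps)
        \<comment> \<open>Both Right moves change only indices up to \<open>Suc i\<close>, below
          \<open>p\<close>; hence \<open>p\<close> and \<open>q\<close> remain the two greatest, and
          their removal commutes with either move.\<close>
        have "top_two (ones A) p q" and pq_B: "top_two (ones B) p q"
          using pq p q kl \<open>l < i\<close> by (auto simp: top_two_def A(2) B)
        then have A': "left_move A p q \<in> left_positions A"
          by (auto simp: top_two_def intro: left_move_in_left_positions)
        have "ones (left_move B p q) = ones (right_move T i (Suc i))"
        proof -
          have "i \<noteq> p" "i \<noteq> q" using p q by auto
          have "ones (right_move T i (Suc i)) = insert i (ones T - {Suc i})"
            using gap_T by (simp add: ones_right_move last_gap_def)
          also have "\<dots> = ones (left_move B p q)"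
            using \<open>i \<noteq> p\<close> \<open>i \<noteq> q\<close> unfolding ones_left_move B T(2) by blast
          finally show ?thesis by (rule sym)
        qed
        moreover have "ones (right_move T k l) = ones (left_move A p q)"
        proof -
          have "k \<noteq> p" "k \<noteq> q"
            using kl(1) \<open>l < i\<close> p q by auto
          then show ?thesis
            unfolding ones_left_move A(2) ones_right_move[OF kl(1) l(2)] T(2) by blast
        qed
        ultimately have "game_of (left_move B p q) \<le> game_of (left_move A p q)"
          using le game_of_le_if_ones_eq order_trans by metis
        from order_trans[OF left_positions_le_top_two[OF pq_B L] this] A' show ?thesis
          by blast
      qed
    qed
  qed
  then show ?case by (simp add: A_def B_def)
qed

section \<open>The greatest 0 and the greatest 1 of a trimmed string\<close>

lemma last_in_ones: "is_position ds \<Longrightarrow> ds \<noteq> [] \<Longrightarrow> length ds - 1 \<in> ones ds"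
  by (simp add: is_position_def ones_def last_conv_nth)

lemma Max_ones_eq_last:
  assumes "is_position ds" "ds \<noteq> []"
  shows "Max (ones ds) = length ds - 1"
  using last_in_ones[OF assms] by (intro Max_eqI finite_ones) (auto simp: ones_def)

text \<open>The last coin is a 1, so the greatest 0 is not in last place and is followed by 1s only,
  at least one of them.\<close>

lemma last_gap_Max_zeros:
  assumes "is_position ds" "zeros ds \<noteq> {}"
  shows "last_gap (ones ds) (Max (zeros ds))"
proof -
  let ?i = "Max (zeros ds)"
  have i: "?i \<in> zeros ds" using assms by (intro Max_in) auto
  have after: "y \<in> ones ds" if "?i < y" "y < length ds" for y
  proof (rule ccontr)
    assume "y \<notin> ones ds"
    with that have "y \<in> zeros ds" by (simp add: zeros_def ones_def)
    then have "y \<le> ?i" by (intro Max_ge) auto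
    with that show False by simp
  qed
  have "ds \<noteq> []" using i by (auto simp: zeros_def)
  then have "length ds - 1 \<in> ones ds" using assms by (intro last_in_ones)
  then have "?i \<noteq> length ds - 1" using i zeros_not_ones by metis
  moreover have "?i < length ds" using i by (simp add: zeros_def)
  ultimately have "Suc ?i < length ds" by simp
  moreover have "y \<in> ones ds" if "x \<in> ones ds" "?i < y" "y < x" for x y
    using that by (intro after) (auto simp: ones_def)
  ultimately show ?thesis
    using zeros_not_ones[OF i] after[of "Suc ?i"] by (simp add: last_gap_def)
qed

theorem theorem4p2:
  fixes ds :: "bool list"
  assumes "is_position ds"
  shows "(card (ones ds) \<ge> 2 \<longrightarrow>
           (let n = Max (ones ds); k = Max (ones ds - {n}) in
              n = length ds - 1 \<and>
              left_move ds k n \<in> left_positions ds \<and>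
              (\<forall>GL \<in> left_positions ds. game_of (left_move ds k n) \<ge> game_of GL))) \<and>
         (zeros ds \<noteq> {} \<longrightarrow>
           (let i = Max (zeros ds) in
              right_move ds i (i + 1) \<in> right_positions ds \<and>
              (\<forall>GR \<in> right_positions ds. game_of (right_move ds i (i + 1)) \<le> game_of GR)))"
proof (intro conjI impI)
  assume "card (ones ds) \<ge> 2"
  then have top: "top_two (ones ds) (Max (ones ds - {Max (ones ds)})) (Max (ones ds))"
    by (intro top_two_Max) auto
  then have "left_move ds (Max (ones ds - {Max (ones ds)})) (Max (ones ds)) \<in> left_positions ds"
    unfolding top_two_def by (intro left_move_in_left_positions) blast+
  moreover from top have "ds \<noteq> []" by (auto simp: top_two_def ones_def)
  ultimately show "let n = Max (ones ds); k = Max (ones ds - {n}) in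
      n = length ds - 1 \<and> left_move ds k n \<in> left_positions ds \<and>
      (\<forall>GL \<in> left_positions ds. game_of (left_move ds k n) \<ge> game_of GL)"
    unfolding Let_def
    by (intro conjI ballI Max_ones_eq_last[OF assms] left_positions_le_top_two[OF top])
next
  assume "zeros ds \<noteq> {}"
  with assms have gap: "last_gap (ones ds) (Max (zeros ds))"
    by (rule last_gap_Max_zeros)
  then have "right_move ds (Max (zeros ds)) (Suc (Max (zeros ds))) \<in> right_positions ds"
    unfolding last_gap_def by (intro right_move_in_right_positions) simp_all
  moreover have "game_of (right_move ds (Max (zeros ds)) (Suc (Max (zeros ds)))) \<le> game_of GR"
    if "GR \<in> right_positions ds" for GR
    using that by (rule right_positionsE) (simp only:, rule right_move_last_gap_le[OF gap])
  ultimately show "let i = Max (zeros ds) in right_move ds i (i + 1) \<in> right_positions ds \<and>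
      (\<forall>GR \<in> right_positions ds. game_of (right_move ds i (i + 1)) \<le> game_of GR)"
    by (simp add: Let_def)
qed

end
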